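(* Let $\alpha_1, \alpha_2 \in \mathbb{R}/\mathbb{Z}$ satisfy $$0 < \liminf_{k\to\infty} k\,\|k\alpha_1\|\,\|k\alpha_2\|,$$ where $k$ runs over positive integers. Then, as $K \to \infty$ through positive integers, $$\sum_{\substack{k=-K\\ k\ne 0}}^K \bigl(\|k\alpha_1\|\,\|k\alpha_2\|\bigr)^{-1} \ll_{\alpha_1,\alpha_2} K(\log K)^2$$ and $$\sum_{\substack{-K\le k_1, k_2\le K\\ (k_1,k_2)\ne(0,0)}} \|k_1\alpha_1 + k_2\alpha_2\|^{-1} \ll_{\alpha_1,\alpha_2} K^2\log K.$$
   Context: For $x \in \mathbb{R}/\mathbb{Z}$, $\|x\|$ is the distance from (any real representative of) $x$ to the nearest integer. The notation $f(K) \ll_{\alpha_1,\alpha_2} g(K)$ as $K\to\infty$ means that there is a finite constant $c$ depending only on $\alpha_1,\alpha_2$ such that $f(K)\le c\, g(K)$ for all sufficiently large $K$. The value $1/0$ is interpreted as $+\infty$. *)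

theory Defs
  imports "HOL-Analysis.Analysis"
begin

text \<open>Elements of \<open>\<real>/\<int>\<close> are given by real representatives; the lemma
  \<open>int_dist_add_of_int\<close> below shows that the choice of representative does not matter.\<close>

definition int_dist :: "real \<Rightarrow> real"  (\<open>\<parallel>_\<parallel>\<close>)
  where "\<parallel>x\<parallel> = infdist x \<int>"

lemma int_dist_add_of_int: "\<parallel>x + of_int n\<parallel> = \<parallel>x\<parallel>"
proof -
  have ne: "\<int> \<noteq> ({} :: real set)"
    using Ints_0 by blast
  have le: "infdist (y + of_int m) \<int> \<le> infdist y \<int>" for y :: real and m :: int
    unfolding infdist_notempty[OF ne]
  proof (rule cINF_mono)
    fix a :: real assume "a \<in> \<int>"
    then show "\<exists>b\<in>\<int>. dist (y + of_int m) b \<le> dist y a"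
      by (intro bexI[of _ "a + of_int m"]) (auto simp: dist_real_def)
  qed (auto intro: ne)
  from le[of x n] le[of "x + of_int n" "- n"] show ?thesis
    by (simp add: int_dist_def)
qed

text \<open>Reciprocals are taken in \<open>ereal\<close>, where \<open>1/0 = +\<infinity>\<close> (in \<open>real\<close> it would be \<open>0\<close>).\<close>

lemma one_divide_ereal_0: "1 / ereal 0 = \<infinity>"
  by (simp add: divide_ereal_def)

end

(* The hypothesis upgrades to c <= k |k a1| |k a2| for all k >= 1. By pigeonhole on differences, at
   most O(K A B) of the 0 < |k| <= K have |k a1| <= A and |k a2| <= B. A transference argument turns
   the same bound into X^2 |k1 a1 + k2 a2| >= c^2/36 with X = max(|k1|, |k2|), so at most O(K^2 t)
   pairs have |k1 a1 + k2 a2| <= t. If at most M t values f x are <= t, the j-th smallest value is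
   at least j/M, so the sum of 1/f is at most M times a harmonic number; for the product of two
   distances this is combined with a dyadic decomposition in the first factor. *)
theory Submission imports Defs begin

section \<open>Basic properties of the distance to the nearest integer\<close>

lemma int_dist_le: "int_dist x \<le> \<bar>x - of_int n\<bar>"
  unfolding int_dist_def using infdist_le[of "of_int n" \<int> x] by (simp add: dist_real_def)

lemma int_dist_attained:
  obtains n :: int where "int_dist x = \<bar>x - of_int n\<bar>"
proof -
  obtain y where y: "y \<in> \<int>" "infdist x \<int> = dist x y"
    using infdist_attains_inf[OF closed_Ints, of x] Ints_0 by blast
  from y(1) obtain n where "y = of_int n" by (elim Ints_cases)
  with y(2) show ?thesis
    by (intro that[of n]) (simp add: int_dist_def dist_real_def)
qed

lemma int_dist_nonneg: "0 \<le> int_dist x"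
  by (simp add: int_dist_def infdist_nonneg)

lemma int_dist_le_half: "int_dist x \<le> 1/2"
  using int_dist_le[of x "round x"] of_int_round_abs_le[of x] by (simp add: abs_minus_commute)

lemma int_dist_diff: "int_dist (x - y) \<le> int_dist x + int_dist y"
proof -
  obtain m where m: "int_dist x = \<bar>x - of_int m\<bar>" by (rule int_dist_attained)
  obtain n where n: "int_dist y = \<bar>y - of_int n\<bar>" by (rule int_dist_attained)
  show ?thesis using int_dist_le[of "x - y" "m - n"] m n by simp
qed

lemma int_dist_minus: "int_dist (- x) = int_dist x"
proof -
  have "int_dist (- x) \<le> int_dist x" for x
    using int_dist_diff[of 0 x] int_dist_le[of 0 0] by simp
  from this[of x] this[of "- x"] show ?thesis by simp
qed

lemma int_dist_abs_mult: "int_dist (of_int \<bar>k\<bar> * x) = int_dist (of_int k * x)"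
  by (cases "k \<ge> 0") (simp_all add: int_dist_minus)

text \<open>Distance zero means that \<open>x\<close> is an integer, and then so are its multiples.
  This later carries a single zero to arbitrarily large indices.\<close>

lemma int_dist_mult_eq_0:
  assumes "int_dist x = 0"
  shows "int_dist (of_int n * x) = 0"
proof -
  obtain m where "int_dist x = \<bar>x - of_int m\<bar>" by (rule int_dist_attained)
  with assms have "x = of_int m" by simp
  then show ?thesis
    using int_dist_le[of "of_int n * x" "n * m"] int_dist_nonneg[of "of_int n * x"] by simp
qed

section \<open>Counting separated integers and pairs of integers\<close>

lemma abs_diff_less_of_div_eq:
  fixes x y m :: int
  assumes "0 < m" "x div m = y div m"
  shows "\<bar>x - y\<bar> < m"
proof -
  have "x - y = x mod m - y mod m"
    using assms(2) div_mult_mod_eq[of x m] div_mult_mod_eq[of y m] by (metis add_diff_cancel_left)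
  moreover have "0 \<le> x mod m" "x mod m < m" "0 \<le> y mod m" "y mod m < m"
    using assms(1) by simp_all
  ultimately show ?thesis by linarith
qed

lemma interval_div_image:
  fixes m x :: int
  assumes "0 < m" "x \<in> {-int K..int K}"
  shows "(x + int K) div m \<in> {0..2 * int K div m}"
proof -
  have "0 \<le> x + int K" "x + int K \<le> 2 * int K" using assms(2) by auto
  then show ?thesis using assms(1) by (simp add: pos_imp_zdiv_nonneg_iff zdiv_mono1)
qed

lemma real_card_div_interval:
  fixes m :: int
  assumes "0 < m"
  shows "real (card {0..2 * int K div m}) \<le> 2 * real K / of_int m + 1"
proof -
  have nn: "0 \<le> 2 * int K div m" using assms by (simp add: pos_imp_zdiv_nonneg_iff)
  then have "real (card {0..2 * int K div m}) = of_int (2 * int K div m) + 1" by simp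
  also have "of_int (2 * int K div m) \<le> 2 * real K / of_int m"
    using real_of_int_div4[of "2 * int K" m] by simp
  finally show ?thesis by simp
qed

text \<open>After a shift by \<open>K\<close> the interval is cut into cells of length
  \<open>m\<close>, and no cell can hold two points of \<open>S\<close>.\<close>

lemma card_separated_le:
  fixes S :: "int set" and m :: int
  assumes "0 < m" "S \<subseteq> {-int K..int K}"
    and sep: "\<And>x y. x \<in> S \<Longrightarrow> y \<in> S \<Longrightarrow> x \<noteq> y \<Longrightarrow> m \<le> \<bar>x - y\<bar>"
  shows "real (card S) \<le> 2 * real K / of_int m + 1"
proof -
  let ?g = "\<lambda>x. (x + int K) div m"
  have "inj_on ?g S"
  proof (rule inj_onI, rule ccontr)
    fix x y assume xy: "x \<in> S" "y \<in> S" "?g x = ?g y" "x \<noteq> y"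
    show False using abs_diff_less_of_div_eq[OF assms(1) xy(3)] sep[OF xy(1,2,4)] by simp
  qed
  moreover have "?g ` S \<subseteq> {0..2 * int K div m}"
    using interval_div_image[OF assms(1)] assms(2) by blast
  ultimately have "card S \<le> card {0..2 * int K div m}" by (intro card_inj_on_le) auto
  then show ?thesis using real_card_div_interval[OF assms(1), of K] by linarith
qed

text \<open>The planar version: square cells of side \<open>m\<close> and separation in the maximum
  norm.\<close>

lemma card_separated_pairs_le:
  fixes S :: "(int \<times> int) set" and m :: int
  assumes "0 < m" "S \<subseteq> {-int K..int K} \<times> {-int K..int K}"
    and sep: "\<And>x y. x \<in> S \<Longrightarrow> y \<in> S \<Longrightarrow> x \<noteq> y \<Longrightarrow> m \<le> max \<bar>fst x - fst y\<bar> \<bar>snd x - snd y\<bar>"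
  shows "real (card S) \<le> (2 * real K / of_int m + 1)\<^sup>2"
proof -
  let ?h = "\<lambda>x. (x + int K) div m"
  let ?g = "\<lambda>x. (?h (fst x), ?h (snd x))"
  let ?I = "{0..2 * int K div m}"
  have "inj_on ?g S"
  proof (rule inj_onI, rule ccontr)
    fix x y assume xy: "x \<in> S" "y \<in> S" "?g x = ?g y" "x \<noteq> y"
    have "\<bar>fst x - fst y\<bar> < m" "\<bar>snd x - snd y\<bar> < m"
      using abs_diff_less_of_div_eq[OF assms(1), of "fst x + int K" "fst y + int K"]
        abs_diff_less_of_div_eq[OF assms(1), of "snd x + int K" "snd y + int K"] xy(3) by simp_all
    then show False using sep[OF xy(1,2,4)] by simp
  qed
  moreover have "?g ` S \<subseteq> ?I \<times> ?I"
  proof safe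
    fix a b assume "(a, b) \<in> S"
    with assms(2) have "a \<in> {-int K..int K}" "b \<in> {-int K..int K}" by blast+
    then show "?h (fst (a, b)) \<in> ?I" "?h (snd (a, b)) \<in> ?I"
      using interval_div_image[OF assms(1)] by simp_all
  qed
  ultimately have "card S \<le> card (?I \<times> ?I)" by (intro card_inj_on_le) auto
  then have "card S \<le> card ?I * card ?I" by (simp only: card_cartesian_product)
  then have "real (card S) \<le> real (card ?I) * real (card ?I)"
    by (metis of_nat_le_iff of_nat_mult)
  also have "\<dots> \<le> (2 * real K / of_int m + 1) * (2 * real K / of_int m + 1)"
    using real_card_div_interval[OF assms(1), of K] by (intro mult_mono) auto
  finally show ?thesis by (simp add: power2_eq_square)
qed

section \<open>Sums of reciprocals from counting bounds\<close>

text \<open>Induction that removes an element \<open>z\<close> with the largest value: its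
  reciprocal is paid for by the last term of the harmonic sum. The disjunct \<open>t \<le> 0\<close>
  restricts the counting bound to positive thresholds.\<close>

lemma sum_inverse_le_harm:
  fixes f :: "'a \<Rightarrow> real"
  assumes "finite S" and "\<And>x. x \<in> S \<Longrightarrow> 0 < f x"
    and "\<And>t. real (card {x \<in> S. f x \<le> t}) \<le> M * t \<or> t \<le> 0"
  shows "(\<Sum>x\<in>S. 1 / f x) \<le> M * harm (card S)"
  using assms
proof (induction "card S" arbitrary: S)
  case 0
  then show ?case by (simp add: harm_def)
next
  case (Suc n)
  then have ne: "S \<noteq> {}" by auto
  have "Max (f ` S) \<in> f ` S" using Suc.prems(1) ne by (intro Max_in) auto
  then obtain z where z0: "z \<in> S" "f z = Max (f ` S)" by auto
  then have z: "z \<in> S" "\<And>x. x \<in> S \<Longrightarrow> f x \<le> f z" using Suc.prems(1) by simp_all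
  have cd: "card (S - {z}) = n" using Suc.hyps(2) z(1) Suc.prems(1) by simp
  have IH: "(\<Sum>x\<in>S - {z}. 1 / f x) \<le> M * harm (card (S - {z}))"
  proof (rule Suc.hyps(1))
    fix t
    have "card {x \<in> S - {z}. f x \<le> t} \<le> card {x \<in> S. f x \<le> t}"
      using Suc.prems(1) by (intro card_mono) auto
    then show "real (card {x \<in> S - {z}. f x \<le> t}) \<le> M * t \<or> t \<le> 0"
      using Suc.prems(3)[of t] by linarith
  qed (use cd Suc.prems in auto)
  \<comment> \<open>At the threshold \<open>f z\<close> all of \<open>S\<close> is counted, so
    \<open>card S \<le> M * f z\<close>.\<close>
  have "{x \<in> S. f x \<le> f z} = S" using z(2) by blast
  then have "real (card S) \<le> M * f z" using Suc.prems(3)[of "f z"] Suc.prems(2)[OF z(1)] by simp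
  then have "1 / f z \<le> M * (1 / real (Suc n))"
    using Suc.prems(2)[OF z(1)] Suc.hyps(2) by (simp add: field_simps)
  moreover have "(\<Sum>x\<in>S. 1 / f x) = 1 / f z + (\<Sum>x\<in>S - {z}. 1 / f x)"
    using z(1) Suc.prems(1) by (simp add: sum.remove)
  ultimately have "(\<Sum>x\<in>S. 1 / f x) \<le> M * (1 / real (Suc n)) + M * harm n"
    using IH cd by simp
  also have "\<dots> = M * harm (card S)"
    by (simp add: Suc.hyps(2)[symmetric] harm_Suc inverse_eq_divide distrib_left)
  finally show ?case .
qed

text \<open>The sequence \<open>harm n - ln n\<close> decreases from its value 1 at
  \<open>n = 1\<close>.\<close>

lemma harm_le_ln:
  assumes "n > 0"
  shows "harm n \<le> ln (real n) + (1 :: real)"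
proof -
  have "harm m - ln (real m) \<le> (1::real)" if "m > 0" for m :: nat
    using euler_mascheroni_sequence_decreasing[of 1 m] that by (simp add: harm_def)
  from this[OF assms] show ?thesis by simp
qed

text \<open>On each dyadic range of \<open>f\<close> the one-variable bound applies to \<open>g\<close>; the hypothesis with
  \<open>A = f x\<close>, \<open>B = 1\<close> gives \<open>f x \<ge> 1/M\<close>, so only \<open>O(log M)\<close> ranges occur.\<close>

lemma sum_inverse_prod_le:
  fixes f g :: "'a \<Rightarrow> real"
  assumes fin: "finite S"
    and f: "\<And>x. x \<in> S \<Longrightarrow> 0 < f x \<and> f x \<le> 1" and g: "\<And>x. x \<in> S \<Longrightarrow> 0 < g x \<and> g x \<le> 1"
    and M: "1 \<le> M"
    and count: "\<And>A B. 0 < A \<Longrightarrow> 0 < B \<Longrightarrow> real (card {x \<in> S. f x \<le> A \<and> g x \<le> B}) \<le> M * A * B"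
  shows "(\<Sum>x\<in>S. 1 / (f x * g x)) \<le> 2 * M * harm (card S) * (log 2 M + 1)"
proof -
  define l where "l x = nat \<lfloor>log 2 (1 / f x)\<rfloor>" for x
  \<comment> \<open>\<open>l x\<close> is the dyadic level: \<open>f x\<close> lies between half of
    \<open>1 / 2 ^ l x\<close> and \<open>1 / 2 ^ l x\<close>.\<close>
  have lev: "f x \<le> 1 / 2 ^ l x \<and> 1 / f x \<le> 2 * 2 ^ l x" if x: "x \<in> S" for x
  proof -
    have pos: "0 < 1 / f x" "1 \<le> 1 / f x" using f[OF x] by simp_all
    then have "0 \<le> log 2 (1 / f x)" by (simp add: zero_le_log_cancel_iff)
    then have "real (l x) \<le> log 2 (1 / f x)" "log 2 (1 / f x) \<le> real (l x + 1)"
      unfolding l_def by linarith+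
    then have "2 powr real (l x) \<le> 1 / f x" "1 / f x \<le> 2 powr real (l x + 1)"
      using pos by (simp_all add: le_log_iff log_le_iff)
    then have "2 ^ l x \<le> 1 / f x" "1 / f x \<le> 2 ^ (l x + 1)"
      by (simp_all only: powr_realpow[of 2, simplified])
    then show ?thesis using f[OF x] by (simp add: field_simps)
  qed
  have lM: "l x \<le> nat \<lfloor>log 2 M\<rfloor>" if x: "x \<in> S" for x
  proof -
    have "{x} \<subseteq> {y \<in> S. f y \<le> f x \<and> g y \<le> 1}" using x g by auto
    then have "card {x} \<le> card {y \<in> S. f y \<le> f x \<and> g y \<le> 1}" using fin by (intro card_mono) auto
    then have "1 \<le> M * f x" using count[of "f x" 1] f[OF x] by simp
    then have "1 / f x \<le> M" using f[OF x] by (simp add: field_simps)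
    then have "log 2 (1 / f x) \<le> log 2 M" using f[OF x] M by simp
    then show ?thesis unfolding l_def by (intro nat_mono floor_mono)
  qed
  have level: "(\<Sum>x\<in>{x \<in> S. l x = i}. 1 / (f x * g x)) \<le> 2 * M * harm (card S)" for i
  proof -
    let ?T = "{x \<in> S. l x = i}"
    have "(\<Sum>x\<in>?T. 1 / g x) \<le> M * (1 / 2 ^ i) * harm (card ?T)"
    proof (rule sum_inverse_le_harm)
      fix t :: real
      show "real (card {x \<in> ?T. g x \<le> t}) \<le> M * (1 / 2 ^ i) * t \<or> t \<le> 0"
      proof (cases "t \<le> 0")
        case False
        have "card {x \<in> ?T. g x \<le> t} \<le> card {x \<in> S. f x \<le> 1 / 2 ^ i \<and> g x \<le> t}"
          using fin lev by (intro card_mono) auto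
        then show ?thesis using count[of "1 / 2 ^ i" t] False by simp
      qed simp
    qed (use fin g in auto)
    also have "\<dots> \<le> M * (1 / 2 ^ i) * harm (card S)"
      using M fin by (intro mult_left_mono harm_mono card_mono) auto
    finally have T: "(\<Sum>x\<in>?T. 1 / g x) \<le> M * (1 / 2 ^ i) * harm (card S)" .
    \<comment> \<open>The loss \<open>2 * 2 ^ i\<close> from \<open>1 / f x\<close> cancels the gain
      \<open>1 / 2 ^ i\<close> from counting, so the bound is the same on every level.\<close>
    have "(\<Sum>x\<in>?T. 1 / (f x * g x)) \<le> (\<Sum>x\<in>?T. 2 * 2 ^ i * (1 / g x))"
    proof (rule sum_mono)
      fix x assume "x \<in> ?T"
      then have x: "x \<in> S" "l x = i" by auto
      have "(1 / f x) * (1 / g x) \<le> 2 * 2 ^ i * (1 / g x)"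
        using lev[OF x(1)] g[OF x(1)] x(2) by (intro mult_right_mono) auto
      then show "1 / (f x * g x) \<le> 2 * 2 ^ i * (1 / g x)" by simp
    qed
    also have "\<dots> = 2 * 2 ^ i * (\<Sum>x\<in>?T. 1 / g x)" by (simp only: sum_distrib_left)
    also have "\<dots> \<le> 2 * 2 ^ i * (M * (1 / 2 ^ i) * harm (card S))"
      by (intro mult_left_mono T) simp
    finally show ?thesis by simp
  qed
  have "(\<Sum>x\<in>S. 1 / (f x * g x)) = (\<Sum>i\<in>{0..nat \<lfloor>log 2 M\<rfloor>}. \<Sum>x\<in>{x \<in> S. l x = i}. 1 / (f x * g x))"
    using fin lM by (intro sum.group[symmetric]) auto
  also have "\<dots> \<le> (\<Sum>i\<in>{0..nat \<lfloor>log 2 M\<rfloor>}. 2 * M * harm (card S))"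
    by (intro sum_mono level)
  also have "\<dots> = 2 * M * harm (card S) * (real (nat \<lfloor>log 2 M\<rfloor>) + 1)"
    by (simp add: algebra_simps)
  also have "\<dots> \<le> 2 * M * harm (card S) * (log 2 M + 1)"
  proof (rule mult_left_mono)
    have "0 \<le> log 2 M" using M by simp
    then show "real (nat \<lfloor>log 2 M\<rfloor>) + 1 \<le> log 2 M + 1" by linarith
  qed (use M harm_nonneg[of "card S", where 'a = real] in simp)
  finally show ?thesis .
qed

section \<open>Transference from products of distances to linear forms\<close>

text \<open>Transference by pigeonhole: among the \<open>q \<le> L\<bar>b\<bar>\<close> two agree both in the cell of length
  \<open>1/L\<close> containing the fractional part of \<open>q\<alpha>\<close> and in the residue of \<open>pq - a\<lfloor>q\<alpha>\<rfloor>\<close> modulo \<open>b\<close>,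
  where \<open>p\<close> is the integer nearest to \<open>a\<alpha> + b\<beta>\<close>. Their difference \<open>q\<close> makes \<open>\<parallel>q\<alpha>\<parallel>\<close> small, and
  the congruence yields an integer close to \<open>q\<beta>\<close>.\<close>

lemma transference_ordered:
  fixes \<alpha> \<beta> c s :: real and a b :: int
  assumes c: "\<And>q::nat. 0 < q \<Longrightarrow> c \<le> real q * int_dist (real q * \<alpha>) * int_dist (real q * \<beta>)"
    and ab: "\<bar>a\<bar> \<le> \<bar>b\<bar>" "b \<noteq> 0"
    and s: "0 < s" "s \<le> 1" and small: "int_dist (of_int a * \<alpha> + of_int b * \<beta>) \<le> s\<^sup>2"
  shows "c \<le> 6 * of_int \<bar>b\<bar> * s"
proof -
  obtain p where "int_dist (of_int a * \<alpha> + of_int b * \<beta>) = \<bar>of_int a * \<alpha> + of_int b * \<beta> - of_int p\<bar>"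
    by (rule int_dist_attained)
  with small have p: "\<bar>of_int a * \<alpha> + of_int b * \<beta> - of_int p\<bar> \<le> s\<^sup>2" by simp
  \<comment> \<open>The number of cells is about \<open>1 / s\<close>: at least that, so a cell has
    length at most \<open>s\<close>, and at most \<open>2 / s\<close> because
    \<open>s \<le> 1\<close>.\<close>
  define L where "L = nat \<lceil>1 / s\<rceil>"
  define X where "X = nat \<bar>b\<bar>"
  have X: "0 < X" "real X = of_int \<bar>b\<bar>" "int X = \<bar>b\<bar>" using ab(2) by (auto simp: X_def)
  have s1: "1 \<le> 1 / s" using s by simp
  then have L1: "1 / s \<le> real L" and L2: "real L \<le> 1 / s + 1" unfolding L_def by linarith+
  have L0: "0 < real L" using L1 s1 by linarith
  have Ls: "real L * s \<le> 2" "1 / real L \<le> s"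
    using L1 L2 s L0 mult_right_mono[OF L2, of s] by (auto simp: field_simps)
  define F where "F q = (\<lfloor>real L * frac (real q * \<alpha>)\<rfloor>, (p * int q - a * \<lfloor>real q * \<alpha>\<rfloor>) mod int X)" for q :: nat
  \<comment> \<open>There are \<open>L * X + 1\<close> indices, counting 0, but only
    \<open>L * X\<close> possible values of \<open>F\<close>.\<close>
  have "\<not> inj_on F {0..L * X}"
  proof (rule pigeonhole)
    have "F ` {0..L * X} \<subseteq> {0..<int L} \<times> {0..<int X}"
    proof safe
      fix q u v assume "(u, v) = F q"
      then have u: "u = \<lfloor>real L * frac (real q * \<alpha>)\<rfloor>" and v: "v = (p * int q - a * \<lfloor>real q * \<alpha>\<rfloor>) mod int X"
        by (simp_all add: F_def)
      have "0 \<le> real L * frac (real q * \<alpha>)" "real L * frac (real q * \<alpha>) < real L"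
        using L0 frac_ge_0[of "real q * \<alpha>"] frac_lt_1[of "real q * \<alpha>"] by simp_all
      then show "u \<in> {0..<int L}" unfolding u by (simp add: floor_less_iff)
      show "v \<in> {0..<int X}" unfolding v using X(1) by simp
    qed
    then have "card (F ` {0..L * X}) \<le> card ({0..<int L} \<times> {0..<int X})"
      by (intro card_mono) auto
    then show "card (F ` {0..L * X}) < card {0..L * X}" by simp
  qed
  then obtain u v where "u \<in> {0..L * X}" "v \<in> {0..L * X}" "F u = F v" "u \<noteq> v"
    by (auto simp: inj_on_def)
  then obtain u v where uv: "u < v" "v \<le> L * X" "F u = F v"
    by (metis atLeastAtMost_iff linorder_neqE_nat)
  define q where "q = v - u"
  define n where "n = \<lfloor>real v * \<alpha>\<rfloor> - \<lfloor>real u * \<alpha>\<rfloor>"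
  have q: "0 < q" "q \<le> L * X" "real q = real v - real u" "int q = int v - int u"
    using uv by (auto simp: q_def)
  have "\<bar>real L * frac (real v * \<alpha>) - real L * frac (real u * \<alpha>)\<bar> \<le> 1"
    using uv(3) unfolding F_def by (simp only: prod.inject) linarith
  then have "real L * \<bar>frac (real v * \<alpha>) - frac (real u * \<alpha>)\<bar> \<le> 1"
    using L0 by (simp add: abs_mult flip: right_diff_distrib)
  then have "\<bar>frac (real v * \<alpha>) - frac (real u * \<alpha>)\<bar> \<le> 1 / real L"
    using L0 by (simp add: field_simps)
  moreover have "frac (real v * \<alpha>) - frac (real u * \<alpha>) = real q * \<alpha> - of_int n"
    by (simp add: frac_def n_def q(3) algebra_simps)
  ultimately have e1: "\<bar>real q * \<alpha> - of_int n\<bar> \<le> 1 / real L" by simp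
  have "int X dvd (p * int v - a * \<lfloor>real v * \<alpha>\<rfloor>) - (p * int u - a * \<lfloor>real u * \<alpha>\<rfloor>)"
    using uv(3)[symmetric] unfolding F_def by (simp add: mod_eq_dvd_iff)
  \<comment> \<open>The two residues agree, and the difference of the floors is \<open>n\<close>.
    The quotient \<open>m\<close> obtained next is the integer close to
    \<open>q * \<beta>\<close>.\<close>
  then have "b dvd p * int q - a * n"
    using X(3) by (simp add: n_def q(4) algebra_simps)
  then obtain m where m: "p * int q - a * n = b * m" by (elim dvdE)
  have mr: "of_int p * real q - of_int a * of_int n = (of_int b * of_int m :: real)"
    using arg_cong[OF m, of "of_int :: int \<Rightarrow> real"] by simp
  \<comment> \<open>Substituting \<open>b * m = p * q - a * n\<close> expresses the error at \<beta>
    through the error of the linear form and the error at \<alpha>, both already small.\<close>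
  have "of_int b * (real q * \<beta> - of_int m)
      = real q * (of_int a * \<alpha> + of_int b * \<beta> - of_int p) - of_int a * (real q * \<alpha> - of_int n)"
    using mr by (simp add: algebra_simps)
  then have "real X * \<bar>real q * \<beta> - of_int m\<bar>
      \<le> real q * \<bar>of_int a * \<alpha> + of_int b * \<beta> - of_int p\<bar> + of_int \<bar>a\<bar> * \<bar>real q * \<alpha> - of_int n\<bar>"
    using abs_triangle_ineq4[of "real q * (of_int a * \<alpha> + of_int b * \<beta> - of_int p)" "of_int a * (real q * \<alpha> - of_int n)"]
    by (simp add: X(2) abs_mult)
  also have "\<dots> \<le> real (L * X) * s\<^sup>2 + real X * (1 / real L)"
  proof (intro add_mono mult_mono p e1)
    \<comment> \<open>The ordering of the coefficients enters here: after division by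
      \<open>X\<close> the error at \<alpha> is not magnified.\<close>
    show "of_int \<bar>a\<bar> \<le> real X" using ab(1) X(2) by linarith
  qed (use q(2) in \<open>simp_all only: of_nat_le_iff of_nat_0_le_iff abs_ge_zero\<close>)
  also have "\<dots> = real X * (real L * s * s + 1 / real L)"
    by (simp add: algebra_simps power2_eq_square)
  finally have "\<bar>real q * \<beta> - of_int m\<bar> \<le> real L * s * s + 1 / real L"
    using X(1) by (simp add: mult_le_cancel_left_pos)
  also have "\<dots> \<le> 2 * s + s" using Ls s by (intro add_mono mult_right_mono) auto
  finally have e2: "int_dist (real q * \<beta>) \<le> 3 * s" using int_dist_le[of "real q * \<beta>" m] by linarith
  have e1': "int_dist (real q * \<alpha>) \<le> s" using int_dist_le[of "real q * \<alpha>" n] e1 Ls(2) by linarith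
  have "c \<le> real q * int_dist (real q * \<alpha>) * int_dist (real q * \<beta>)" by (rule c[OF q(1)])
  \<comment> \<open>One factor \<open>s\<close> is absorbed by \<open>L * s \<le> 2\<close>, which
    gives the constant 6.\<close>
  also have "\<dots> \<le> real (L * X) * s * (3 * s)"
    using q(2) e1' e2 s by (intro mult_mono mult_nonneg_nonneg int_dist_nonneg) (simp_all only: of_nat_le_iff of_nat_0_le_iff less_imp_le)
  also have "\<dots> = (real L * s) * (3 * real X * s)" by (simp add: algebra_simps)
  also have "\<dots> \<le> 2 * (3 * real X * s)" using Ls(1) s by (intro mult_right_mono) auto
  finally show ?thesis using X(2) by simp
qed

text \<open>A violation would make \<open>sqrt \<delta>\<close> smaller than
  \<open>c / (6 * X)\<close>, and any \<open>s\<close> strictly between the two contradicts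
  \<open>transference_ordered\<close>. The 36 is the square of the 6 there. If the first coefficient
  is the larger one, \<alpha> and \<beta> exchange roles.\<close>

lemma transference:
  fixes \<alpha> \<beta> c :: real and a b :: int
  assumes c0: "0 < c"
    and c: "\<And>q::nat. 0 < q \<Longrightarrow> c \<le> real q * int_dist (real q * \<alpha>) * int_dist (real q * \<beta>)"
    and ab: "(a, b) \<noteq> (0, 0)"
  shows "c\<^sup>2 / 36 \<le> (of_int (max \<bar>a\<bar> \<bar>b\<bar>))\<^sup>2 * int_dist (of_int a * \<alpha> + of_int b * \<beta>)"
proof (rule ccontr)
  define X where "X = (of_int (max \<bar>a\<bar> \<bar>b\<bar>) :: real)"
  define \<delta> where "\<delta> = int_dist (of_int a * \<alpha> + of_int b * \<beta>)"
  assume "\<not> c\<^sup>2 / 36 \<le> (of_int (max \<bar>a\<bar> \<bar>b\<bar>))\<^sup>2 * int_dist (of_int a * \<alpha> + of_int b * \<beta>)"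
  then have neg: "X\<^sup>2 * \<delta> < c\<^sup>2 / 36" by (simp only: X_def \<delta>_def not_le)
  have \<delta>: "0 \<le> \<delta>" by (simp add: \<delta>_def int_dist_nonneg)
  have "1 \<le> max \<bar>a\<bar> \<bar>b\<bar>" using ab by auto
  then have X: "1 \<le> X" unfolding X_def by linarith
  have "c \<le> 1 * int_dist (1 * \<alpha>) * int_dist (1 * \<beta>)" using c[of 1] by simp
  also have "\<dots> \<le> 1 * 1 * 1"
    using int_dist_le_half[of "1 * \<alpha>"] int_dist_le_half[of "1 * \<beta>"]
    by (intro mult_mono) (auto intro: int_dist_nonneg)
  finally have c1: "c \<le> 1" by simp
  have "(X * sqrt \<delta>)\<^sup>2 < (c / 6)\<^sup>2"
    using neg real_sqrt_pow2[OF \<delta>] by (simp only: power_mult_distrib power_divide) simp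
  then have "X * sqrt \<delta> < c / 6" using power2_less_imp_less c0 by fastforce
  then have "sqrt \<delta> < c / 6 / X" using X by (simp add: field_simps)
  \<comment> \<open>Strictness on the left keeps \<open>s\<close> positive even if \<delta> is
    0.\<close>
  then obtain s where s: "sqrt \<delta> < s" "s < c / 6 / X" using dense by blast
  have s0: "0 < s" using s(1) real_sqrt_ge_zero[OF \<delta>] by linarith
  have Xs: "6 * X * s < c" using s(2) X by (simp add: field_simps)
  moreover have "s \<le> X * s" using X s0 mult_right_mono[of 1 X s] by simp
  ultimately have s1: "s \<le> 1" using c1 s0 by linarith
  have small: "int_dist (of_int a * \<alpha> + of_int b * \<beta>) \<le> s\<^sup>2"
    using s(1) by (simp add: sqrt_le_D less_imp_le flip: \<delta>_def)
  have "c \<le> 6 * X * s"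
  proof (cases "\<bar>a\<bar> \<le> \<bar>b\<bar>")
    case True
    then have "b \<noteq> 0" "X = of_int \<bar>b\<bar>" using ab by (auto simp: X_def max_def)
    then show ?thesis using transference_ordered[OF c True _ s0 s1 small] by simp
  next
    case False
    then have ba: "\<bar>b\<bar> \<le> \<bar>a\<bar>" by simp
    have "c \<le> real q * int_dist (real q * \<beta>) * int_dist (real q * \<alpha>)" if "0 < q" for q
      using c[OF that] by (simp add: mult_ac)
    moreover have "int_dist (of_int b * \<beta> + of_int a * \<alpha>) \<le> s\<^sup>2" using small by (simp add: add.commute)
    moreover have "a \<noteq> 0" "X = of_int \<bar>a\<bar>" using False by (auto simp: X_def max_def)
    ultimately show ?thesis using transference_ordered[of c \<beta> \<alpha> b a s] ba s0 s1 by simp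
  qed
  with Xs show False by simp
qed

section \<open>Counting integers and pairs with small distances\<close>

text \<open>Two counted integers differ by some \<open>k\<close> whose distances are at most
  \<open>2 * A\<close> and \<open>2 * B\<close>, so the lower bound \<open>c\<close> forces a gap of
  at least \<open>c / (4 * A * B)\<close>.\<close>

lemma card_small_product_le:
  fixes \<alpha> \<beta> c A B :: real
  assumes c0: "0 < c"
    and c: "\<And>k::int. k \<noteq> 0 \<Longrightarrow> c \<le> of_int \<bar>k\<bar> * int_dist (of_int k * \<alpha>) * int_dist (of_int k * \<beta>)"
    and AB: "0 < A" "0 < B"
  shows "real (card {k \<in> {-int K..int K} - {0}. int_dist (of_int k * \<alpha>) \<le> A \<and> int_dist (of_int k * \<beta>) \<le> B})
    \<le> 9 * real K / c * A * B"
proof -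
  define S where "S = {k \<in> {-int K..int K} - {0}. int_dist (of_int k * \<alpha>) \<le> A \<and> int_dist (of_int k * \<beta>) \<le> B}"
  define m where "m = \<lceil>c / (4 * A * B)\<rceil>"
  have pos: "0 < c / (4 * A * B)" using c0 AB by simp
  then have m: "0 < m" "c / (4 * A * B) \<le> of_int m" unfolding m_def by (simp, linarith)
  have "real (card S) \<le> 2 * real K / of_int m + 1"
  proof (rule card_separated_le[OF m(1)])
    fix x y assume xy: "x \<in> S" "y \<in> S" "x \<noteq> y"
    have "int_dist (of_int (x - y) * \<alpha>) \<le> 2 * A" "int_dist (of_int (x - y) * \<beta>) \<le> 2 * B"
      using int_dist_diff[of "of_int x * \<alpha>" "of_int y * \<alpha>"] int_dist_diff[of "of_int x * \<beta>" "of_int y * \<beta>"] xy(1,2)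
      by (auto simp: S_def left_diff_distrib)
    then have "of_int \<bar>x - y\<bar> * int_dist (of_int (x - y) * \<alpha>) * int_dist (of_int (x - y) * \<beta>)
        \<le> of_int \<bar>x - y\<bar> * (2 * A) * (2 * B)"
      using AB by (intro mult_mono mult_nonneg_nonneg int_dist_nonneg) auto
    with c[of "x - y"] xy(3) have "c \<le> of_int \<bar>x - y\<bar> * (2 * A) * (2 * B)" by linarith
    then have "c / (4 * A * B) \<le> of_int \<bar>x - y\<bar>" using AB by (simp add: field_simps)
    then show "m \<le> \<bar>x - y\<bar>" unfolding m_def by (simp add: ceiling_le_iff)
  qed (auto simp: S_def)
  also have "\<dots> \<le> 2 * real K / (c / (4 * A * B)) + 1"
    using m pos by (intro add_right_mono divide_left_mono mult_pos_pos) simp_all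
  finally have S: "real (card S) \<le> 8 * (real K / c * A * B) + 1" by (simp add: field_simps)
  \<comment> \<open>The additive 1 is absorbed: one element of \<open>S\<close> already forces
    \<open>c \<le> K * A * B\<close>.\<close>
  have "real (card S) \<le> 9 * (real K / c * A * B)"
  proof (cases "S = {}")
    case False
    then obtain k where k: "k \<in> S" by blast
    then have "c \<le> of_int \<bar>k\<bar> * int_dist (of_int k * \<alpha>) * int_dist (of_int k * \<beta>)"
      by (intro c) (auto simp: S_def)
    also have "\<dots> \<le> real K * A * B"
      using k AB by (intro mult_mono mult_nonneg_nonneg int_dist_nonneg) (auto simp: S_def)
    finally have "1 \<le> real K / c * A * B" using c0 by (simp add: field_simps)
    then have "8 * (real K / c * A * B) + 1 \<le> 9 * (real K / c * A * B)" by argo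
    with S show ?thesis by (rule order_trans)
  qed (use AB c0 in simp)
  then show ?thesis by (simp add: S_def)
qed

text \<open>The linear form is at most \<open>2 * t\<close> at a difference of two counted pairs, so
  the pairs are \<open>r\<close>-separated in the maximum norm, where \<open>r\<close> squared is
  \<open>d / (2 * t)\<close>.\<close>

lemma card_small_linear_form_le:
  fixes \<alpha> \<beta> d t :: real
  assumes d0: "0 < d"
    and d: "\<And>a b. (a, b) \<noteq> (0, 0) \<Longrightarrow>
      d \<le> (of_int (max \<bar>a\<bar> \<bar>b\<bar>))\<^sup>2 * int_dist (of_int a * \<alpha> + of_int b * \<beta>)"
    and t: "0 < t"
  shows "real (card {x \<in> {-int K..int K} \<times> {-int K..int K} - {(0, 0)}.
      int_dist (of_int (fst x) * \<alpha> + of_int (snd x) * \<beta>) \<le> t}) \<le> 18 * (real K)\<^sup>2 / d * t"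
proof -
  define N where "N x = int_dist (of_int (fst x) * \<alpha> + of_int (snd x) * \<beta>)" for x :: "int \<times> int"
  define S where "S = {x \<in> {-int K..int K} \<times> {-int K..int K} - {(0, 0)}. N x \<le> t}"
  define r where "r = sqrt (d / (2 * t))"
  define m where "m = \<lceil>r\<rceil>"
  have r: "0 < r" "r\<^sup>2 = d / (2 * t)" using d0 t by (simp_all add: r_def)
  have m: "0 < m" "r \<le> of_int m" using r(1) unfolding m_def by (simp, linarith)
  have "real (card S) \<le> (2 * real K / of_int m + 1)\<^sup>2"
  proof (rule card_separated_pairs_le[OF m(1)])
    fix x y assume xy: "x \<in> S" "y \<in> S" "x \<noteq> y"
    let ?w = "max \<bar>fst x - fst y\<bar> \<bar>snd x - snd y\<bar>"
    have ne: "(fst x - fst y, snd x - snd y) \<noteq> (0, 0)" using xy(3) by (auto simp: prod_eq_iff)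
    have "int_dist (of_int (fst x - fst y) * \<alpha> + of_int (snd x - snd y) * \<beta>) \<le> N x + N y"
      using int_dist_diff[of "of_int (fst x) * \<alpha> + of_int (snd x) * \<beta>" "of_int (fst y) * \<alpha> + of_int (snd y) * \<beta>"]
      by (simp add: N_def algebra_simps)
    also have "\<dots> \<le> 2 * t" using xy by (simp add: S_def)
    finally have "(of_int ?w)\<^sup>2 * int_dist (of_int (fst x - fst y) * \<alpha> + of_int (snd x - snd y) * \<beta>)
        \<le> (of_int ?w)\<^sup>2 * (2 * t)" by (rule mult_left_mono) simp
    with d[OF ne] have "d \<le> (of_int ?w)\<^sup>2 * (2 * t)" by linarith
    then have "r\<^sup>2 \<le> (of_int ?w)\<^sup>2" using t by (simp add: r(2) field_simps)
    then have "r \<le> of_int ?w" by (rule power2_le_imp_le) simp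
    then show "m \<le> ?w" unfolding m_def by (simp only: ceiling_le_iff)
  qed (auto simp: S_def)
  also have "\<dots> \<le> (2 * real K / r + 1)\<^sup>2"
    using m r(1) by (intro power_mono add_right_mono divide_left_mono) auto
  also have "\<dots> \<le> 2 * ((2 * real K / r)\<^sup>2 + 1)"
    using sum_squares_bound[of "2 * real K / r" 1] by (simp add: power2_sum)
  also have "(2 * real K / r)\<^sup>2 = 8 * ((real K)\<^sup>2 / d * t)"
    using d0 t by (simp add: power_divide power_mult_distrib r(2))
  finally have S: "real (card S) \<le> 16 * ((real K)\<^sup>2 / d * t) + 2" by simp
  \<comment> \<open>The additive 2 is absorbed as before, since one element of \<open>S\<close>
    gives \<open>d\<close> at most \<open>t\<close> times the square of \<open>K\<close>.\<close>
  have "real (card S) \<le> 18 * ((real K)\<^sup>2 / d * t)"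
  proof (cases "S = {}")
    case False
    then obtain a b where k: "(a, b) \<in> S" by auto
    then have "d \<le> (of_int (max \<bar>a\<bar> \<bar>b\<bar>))\<^sup>2 * int_dist (of_int a * \<alpha> + of_int b * \<beta>)"
      by (intro d) (auto simp: S_def)
    also have "\<dots> \<le> (real K)\<^sup>2 * t"
      using k by (intro mult_mono power_mono int_dist_nonneg) (auto simp: S_def N_def)
    finally have "1 \<le> (real K)\<^sup>2 / d * t" using d0 by (simp add: field_simps)
    with S show ?thesis by linarith
  qed (use d0 t in simp)
  then show ?thesis by (simp add: S_def N_def)
qed

section \<open>From the lower limit to a uniform lower bound\<close>

text \<open>The lower limit controls all \<open>k\<close> from some \<open>n\<close> on. The
  finitely many smaller \<open>k\<close> only need nonzero values, since a minimum can then be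
  taken.\<close>

lemma uniform_lower_bound_of_liminf:
  fixes \<alpha> \<beta> :: real
  assumes "0 < liminf (\<lambda>k::nat. ereal (real k * int_dist (real k * \<alpha>) * int_dist (real k * \<beta>)))"
  obtains c where "0 < c"
    "\<And>k::nat. 0 < k \<Longrightarrow> c \<le> real k * int_dist (real k * \<alpha>) * int_dist (real k * \<beta>)"
proof -
  define h where "h k = real k * int_dist (real k * \<alpha>) * int_dist (real k * \<beta>)" for k :: nat
  have "0 < liminf (\<lambda>k. ereal (h k))" using assms by (simp add: h_def)
  then obtain e where e: "0 < e" "e < liminf (\<lambda>k. ereal (h k))" using dense by blast
  then have "\<forall>\<^sub>F k in sequentially. e < ereal (h k)" using less_LiminfD by blast
  then obtain n where n: "\<And>k. n \<le> k \<Longrightarrow> e < ereal (h k)" by (auto simp: eventually_sequentially)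
  have "e < \<infinity>" using n[of n] by (cases e) auto
  then obtain c0 where c0: "e = ereal c0" "0 < c0" using e(1) by (cases e) auto
  have big: "c0 < h k" if "n \<le> k" for k using n[OF that] c0(1) by simp
  have pos: "0 < h k" if "0 < k" for k
  proof (rule ccontr)
    assume "\<not> 0 < h k"
    then have "int_dist (real k * \<alpha>) = 0 \<or> int_dist (real k * \<beta>) = 0"
      using that int_dist_nonneg[of "real k * \<alpha>"] int_dist_nonneg[of "real k * \<beta>"]
      by (auto simp: h_def zero_less_mult_iff)
    \<comment> \<open>A zero at \<open>k\<close> passes to the multiple \<open>n * k\<close>, which
      is at least \<open>n\<close> and so falls in the range of \<open>big\<close>.\<close>
    then have "int_dist (real (n * k) * \<alpha>) = 0 \<or> int_dist (real (n * k) * \<beta>) = 0"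
      using int_dist_mult_eq_0[of _ "int n"] by (auto simp: mult.assoc)
    then have "h (n * k) = 0" by (auto simp: h_def)
    with big[of "n * k"] that c0(2) show False by simp
  qed
  define c where "c = Min (insert c0 (h ` {1..n}))"
  show ?thesis
  proof (rule that[of c])
    show "0 < c" unfolding c_def using c0(2) pos by (subst Min_gr_iff) auto
    fix k :: nat assume k: "0 < k"
    have "c \<le> h k"
    proof (cases "k \<le> n")
      case True
      then show ?thesis unfolding c_def using k by (intro Min_le) auto
    next
      case False
      have "c \<le> c0" unfolding c_def by (intro Min_le) auto
      then show ?thesis using big[of k] False by simp
    qed
    then show "c \<le> real k * int_dist (real k * \<alpha>) * int_dist (real k * \<beta>)" by (simp add: h_def)
  qed
qed

section \<open>Explicit bounds for both sums\<close>

text \<open>With \<open>M = 9 * K / c\<close> from the counting lemma, the harmonic number and the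
  number of dyadic levels each contribute one factor \<open>ln K\<close>. The constant is
  \<open>54 = 2 * 9 * 3\<close>.\<close>

lemma sum_inverse_product_bound:
  fixes \<alpha> \<beta> c :: real
  assumes c0: "0 < c" "c \<le> 1"
    and c: "\<And>k::int. k \<noteq> 0 \<Longrightarrow> c \<le> of_int \<bar>k\<bar> * int_dist (of_int k * \<alpha>) * int_dist (of_int k * \<beta>)"
    and pos: "\<And>k::int. k \<noteq> 0 \<Longrightarrow> 0 < int_dist (of_int k * \<alpha>) \<and> 0 < int_dist (of_int k * \<beta>)"
    and K: "3 \<le> K"
  shows "(\<Sum>k\<in>{-int K..int K} - {0}. 1 / (int_dist (of_int k * \<alpha>) * int_dist (of_int k * \<beta>)))
    \<le> 54 / c * ((ln (9 / c) + 1) / ln 2 + 1) * (real K * (ln (real K))\<^sup>2)"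
proof -
  \<comment> \<open>Since e is at most 3, \<open>3 \<le> K\<close> suffices. Additive constants can
    then be absorbed into multiples of \<open>ln K\<close>.\<close>
  have l1: "1 \<le> ln (real K)"
    using K exp_le by (subst ln_ge_iff) auto
  define l where "l = ln (real K)"
  define M where "M = 9 * real K / c"
  define u where "u = ln (9 / c)"
  have c9: "1 \<le> 9 / c" using c0 by (simp add: field_simps)
  have u: "0 \<le> u" unfolding u_def using c9 by simp
  have M: "1 \<le> M" using c0 K by (simp add: M_def field_simps)
  have "ln M = u + l" using c0 K unfolding M_def u_def l_def by (simp add: ln_mult ln_div)
  also have "\<dots> \<le> (u + 1) * l" using u l1 mult_left_mono[of 1 l u] by (simp add: l_def distrib_right)
  finally have "ln M / ln 2 \<le> (u + 1) * l / ln 2" by (intro divide_right_mono) auto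
  then have lM: "log 2 M + 1 \<le> ((u + 1) / ln 2 + 1) * l" using l1 by (simp add: log_def l_def distrib_right)
  let ?S = "{-int K..int K} - {0}"
  have card: "card ?S = 2 * K" by simp
  have "ln (2 * real K) = ln 2 + l" using K by (simp add: ln_mult l_def)
  moreover have "ln 2 \<le> (1::real)" using ln_le_minus_one[of 2] by simp
  ultimately have harm: "harm (card ?S) \<le> 3 * l"
    using harm_le_ln[of "2 * K"] card K l1 by (simp add: l_def)
  have "(\<Sum>k\<in>?S. 1 / (int_dist (of_int k * \<alpha>) * int_dist (of_int k * \<beta>))) \<le> 2 * M * harm (card ?S) * (log 2 M + 1)"
  proof (rule sum_inverse_prod_le)
    fix k assume "k \<in> ?S"
    then have "k \<noteq> 0" by simp
    then show "0 < int_dist (of_int k * \<alpha>) \<and> int_dist (of_int k * \<alpha>) \<le> 1"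
      "0 < int_dist (of_int k * \<beta>) \<and> int_dist (of_int k * \<beta>) \<le> 1"
      using pos int_dist_le_half[of "of_int k * \<alpha>"] int_dist_le_half[of "of_int k * \<beta>"] by auto
  next
    fix A B :: real assume "0 < A" "0 < B"
    then show "real (card {k \<in> ?S. int_dist (of_int k * \<alpha>) \<le> A \<and> int_dist (of_int k * \<beta>) \<le> B}) \<le> M * A * B"
      unfolding M_def by (intro card_small_product_le c0 c)
  qed (use M in auto)
  also have "\<dots> \<le> 2 * M * (3 * l) * (((u + 1) / ln 2 + 1) * l)"
  proof (intro mult_mono mult_left_mono harm lM)
    show "0 \<le> log 2 M + 1" using zero_le_log_cancel_iff[of 2 M] M by linarith
  qed (use M l1 in \<open>simp_all add: l_def harm_nonneg\<close>)
  also have "\<dots> = 54 / c * ((u + 1) / ln 2 + 1) * (real K * l\<^sup>2)"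
    by (simp add: M_def power2_eq_square)
  finally show ?thesis by (simp add: u_def l_def)
qed

text \<open>Only one distance occurs, so the harmonic bound applies directly and costs a single
  logarithm. The constant is \<open>108 = 18 * 6\<close>.\<close>

lemma sum_inverse_linear_form_bound:
  fixes \<alpha> \<beta> d :: real
  assumes d0: "0 < d"
    and d: "\<And>a b. (a, b) \<noteq> (0, 0) \<Longrightarrow>
      d \<le> (of_int (max \<bar>a\<bar> \<bar>b\<bar>))\<^sup>2 * int_dist (of_int a * \<alpha> + of_int b * \<beta>)"
    and pos: "\<And>a b. (a, b) \<noteq> (0, 0) \<Longrightarrow> 0 < int_dist (of_int a * \<alpha> + of_int b * \<beta>)"
    and K: "3 \<le> K"
  shows "(\<Sum>x\<in>{-int K..int K} \<times> {-int K..int K} - {(0, 0)}.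
      1 / int_dist (of_int (fst x) * \<alpha> + of_int (snd x) * \<beta>)) \<le> 108 / d * ((real K)\<^sup>2 * ln (real K))"
proof -
  let ?S = "{-int K..int K} \<times> {-int K..int K} - {(0, 0)}"
  define l where "l = ln (real K)"
  have l1: "1 \<le> l" unfolding l_def
    using K exp_le by (subst ln_ge_iff) auto
  have "nat (2 * int K + 1) = 2 * K + 1" by linarith
  then have "card ?S = (2 * K + 1) * (2 * K + 1) - 1"
    by (subst card_Diff_subset) (auto simp: card_cartesian_product)
  also have "\<dots> = 4 * K * (K + 1)" by (simp add: algebra_simps)
  also have "\<dots> \<le> 4 * K * (2 * K)" using K by (intro mult_left_mono) auto
  also have "\<dots> = 8 * K\<^sup>2" by (simp add: power2_eq_square)
  finally have card: "card ?S \<le> 8 * K\<^sup>2" .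
  have "harm (card ?S) \<le> (harm (8 * K\<^sup>2) :: real)" using card by (rule harm_mono)
  also have "\<dots> \<le> ln (real (8 * K\<^sup>2)) + 1" using K by (intro harm_le_ln) auto
  also have "ln (real (8 * K\<^sup>2)) = ln (2 ^ 3) + 2 * l"
    using K by (simp add: ln_mult ln_realpow l_def)
  also have "ln ((2::real) ^ 3) = 3 * ln 2" by (subst ln_realpow) auto
  \<comment> \<open>As \<open>ln 2 \<le> 25 / 36\<close>, the constants \<open>3 * ln 2 + 1\<close>
    stay below \<open>4 * l\<close>.\<close>
  also have "3 * ln 2 + 2 * l + 1 \<le> 6 * l" using l1 ln2_le_25_over_36 by linarith
  finally have harm: "harm (card ?S) \<le> 6 * l" .
  have "(\<Sum>x\<in>?S. 1 / int_dist (of_int (fst x) * \<alpha> + of_int (snd x) * \<beta>)) \<le> 18 * (real K)\<^sup>2 / d * harm (card ?S)"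
  proof (rule sum_inverse_le_harm)
    fix x assume "x \<in> ?S"
    then show "0 < int_dist (of_int (fst x) * \<alpha> + of_int (snd x) * \<beta>)" by (intro pos) auto
  next
    fix t :: real
    show "real (card {x \<in> ?S. int_dist (of_int (fst x) * \<alpha> + of_int (snd x) * \<beta>) \<le> t}) \<le> 18 * (real K)\<^sup>2 / d * t \<or> t \<le> 0"
      using card_small_linear_form_le[OF d0 d, of t K] by linarith
  qed auto
  also have "\<dots> \<le> 18 * (real K)\<^sup>2 / d * (6 * l)" using d0 by (intro mult_left_mono harm) auto
  finally show ?thesis by (simp add: l_def)
qed

section \<open>Passage to extended reals and conclusion\<close>

text \<open>Positivity excludes the case \<open>1 / 0 = \<infinity>\<close>, so the real bounds
  carry over to the sums in the theorem.\<close>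

lemma sum_one_divide_ereal:
  assumes "\<And>x. x \<in> S \<Longrightarrow> 0 < f x"
  shows "(\<Sum>x\<in>S. 1 / ereal (f x)) = ereal (\<Sum>x\<in>S. 1 / f x)"
proof -
  have "(\<Sum>x\<in>S. 1 / ereal (f x)) = (\<Sum>x\<in>S. ereal (1 / f x))"
    using assms by (intro sum.cong) (force simp: one_ereal_def)+
  then show ?thesis by simp
qed

theorem mainTheorem7:
  fixes \<alpha>\<^sub>1 \<alpha>\<^sub>2 :: real
  assumes "0 < liminf (\<lambda>k::nat. ereal (real k * \<parallel>real k * \<alpha>\<^sub>1\<parallel> * \<parallel>real k * \<alpha>\<^sub>2\<parallel>))"
  shows "(\<exists>c::real. \<forall>\<^sub>F K::nat in sequentially.
            (\<Sum>k \<in> {-int K..int K} - {0}.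
               1 / ereal (\<parallel>of_int k * \<alpha>\<^sub>1\<parallel> * \<parallel>of_int k * \<alpha>\<^sub>2\<parallel>))
            \<le> ereal (c * (real K * (ln (real K))\<^sup>2)))
       \<and> (\<exists>c::real. \<forall>\<^sub>F K::nat in sequentially.
            (\<Sum>(k\<^sub>1, k\<^sub>2) \<in> {-int K..int K} \<times> {-int K..int K} - {(0, 0)}.
               1 / ereal (\<parallel>of_int k\<^sub>1 * \<alpha>\<^sub>1 + of_int k\<^sub>2 * \<alpha>\<^sub>2\<parallel>))
            \<le> ereal (c * ((real K)\<^sup>2 * ln (real K))))"
proof -
  obtain c where c0: "0 < c"
    and c: "\<And>k::nat. 0 < k \<Longrightarrow> c \<le> real k * int_dist (real k * \<alpha>\<^sub>1) * int_dist (real k * \<alpha>\<^sub>2)"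
    using uniform_lower_bound_of_liminf[OF assms] by blast
  \<comment> \<open>The distance is even, so the bound for positive \<open>k\<close> extends to
    negative \<open>k\<close>.\<close>
  have cZ: "c \<le> of_int \<bar>k\<bar> * int_dist (of_int k * \<alpha>\<^sub>1) * int_dist (of_int k * \<alpha>\<^sub>2)" if "k \<noteq> 0" for k :: int
  proof -
    have "real (nat \<bar>k\<bar>) = of_int \<bar>k\<bar>" by simp
    with c[of "nat \<bar>k\<bar>"] that show ?thesis by (simp only: int_dist_abs_mult)
  qed
  have posZ: "0 < int_dist (of_int k * \<alpha>\<^sub>1) \<and> 0 < int_dist (of_int k * \<alpha>\<^sub>2)" if "k \<noteq> 0" for k :: int
    using cZ[OF that] c0 int_dist_nonneg[of "of_int k * \<alpha>\<^sub>1"] int_dist_nonneg[of "of_int k * \<alpha>\<^sub>2"]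
    by (auto simp: less_le)
  have "int_dist \<alpha>\<^sub>1 * int_dist \<alpha>\<^sub>2 \<le> 1 * 1"
    using int_dist_le_half[of \<alpha>\<^sub>1] int_dist_le_half[of \<alpha>\<^sub>2] by (intro mult_mono int_dist_nonneg) auto
  then have c1: "c \<le> 1" using c[of 1] by simp
  define d where "d = c\<^sup>2 / 36"
  have d0: "0 < d" using c0 by (simp add: d_def)
  have d: "d \<le> (of_int (max \<bar>a\<bar> \<bar>b\<bar>))\<^sup>2 * int_dist (of_int a * \<alpha>\<^sub>1 + of_int b * \<alpha>\<^sub>2)"
    if "(a, b) \<noteq> (0, 0)" for a b :: int
    unfolding d_def using c0 c that by (rule transference)
  have posP: "0 < int_dist (of_int a * \<alpha>\<^sub>1 + of_int b * \<alpha>\<^sub>2)" if "(a, b) \<noteq> (0, 0)" for a b :: int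
    using d[OF that] d0 int_dist_nonneg[of "of_int a * \<alpha>\<^sub>1 + of_int b * \<alpha>\<^sub>2"] by (auto simp: less_le)
  show ?thesis
  \<comment> \<open>The two constants stay schematic until the \<open>show\<close> statements fix
    them. They are built from \<open>c\<close> alone, hence depend only on the two given
    reals.\<close>
  proof (intro conjI exI eventually_mono[OF eventually_ge_at_top[of 3]])
    fix K :: nat assume K: "3 \<le> K"
    have "(\<Sum>k \<in> {-int K..int K} - {0}. 1 / ereal (int_dist (of_int k * \<alpha>\<^sub>1) * int_dist (of_int k * \<alpha>\<^sub>2)))
        = ereal (\<Sum>k\<in>{-int K..int K} - {0}. 1 / (int_dist (of_int k * \<alpha>\<^sub>1) * int_dist (of_int k * \<alpha>\<^sub>2)))"
      using posZ by (intro sum_one_divide_ereal) simp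
    then show "(\<Sum>k \<in> {-int K..int K} - {0}. 1 / ereal (int_dist (of_int k * \<alpha>\<^sub>1) * int_dist (of_int k * \<alpha>\<^sub>2)))
        \<le> ereal (54 / c * ((ln (9 / c) + 1) / ln 2 + 1) * (real K * (ln (real K))\<^sup>2))"
      using sum_inverse_product_bound[OF c0 c1 cZ posZ K] by simp
  next
    fix K :: nat assume K: "3 \<le> K"
    let ?S = "{-int K..int K} \<times> {-int K..int K} - {(0, 0)}"
    have "(\<Sum>(k\<^sub>1, k\<^sub>2) \<in> ?S. 1 / ereal (int_dist (of_int k\<^sub>1 * \<alpha>\<^sub>1 + of_int k\<^sub>2 * \<alpha>\<^sub>2)))
        = (\<Sum>x \<in> ?S. 1 / ereal (int_dist (of_int (fst x) * \<alpha>\<^sub>1 + of_int (snd x) * \<alpha>\<^sub>2)))"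
      by (intro sum.cong) auto
    also have "\<dots> = ereal (\<Sum>x\<in>?S. 1 / int_dist (of_int (fst x) * \<alpha>\<^sub>1 + of_int (snd x) * \<alpha>\<^sub>2))"
      by (intro sum_one_divide_ereal posP) auto
    finally show "(\<Sum>(k\<^sub>1, k\<^sub>2) \<in> ?S. 1 / ereal (int_dist (of_int k\<^sub>1 * \<alpha>\<^sub>1 + of_int k\<^sub>2 * \<alpha>\<^sub>2)))
        \<le> ereal (108 / d * ((real K)\<^sup>2 * ln (real K)))"
      using sum_inverse_linear_form_bound[OF d0 d posP K] by simp
  qed
qed

end
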